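(* Let $G$ be an $n$-vertex graph, let $t\ge2$ be an integer, and let $\mathbf{c}=(c_i)_{i\ge1}$ be a sequence of nonnegative real numbers. Then there exist $n$-vertex complete multipartite graphs $H$ and $H'$ such that $\mathrm{cov}^*_t(G,\mathbf{c})\le\mathrm{cov}^*_t(H,\mathbf{c})$ and $\mathrm{dec}^*_t(G,\mathbf{c})\le\mathrm{dec}^*_t(H',\mathbf{c})$.
   Context: All graphs are finite and simple. A clique of $G$ is a nonempty set of pairwise adjacent vertices; $\mathcal{K}(G)$ is the set of cliques of $G$ and $\mathcal{K}_t(G)$ the set of cliques with exactly $t$ vertices. For $f:\mathcal{K}(G)\to\mathbb{R}$, its $\mathbf{c}$-cost is $\|f\|_{\mathbf{c}}=\sum_{K\in\mathcal{K}(G)}c_{|K|}f(K)$. A fractional $t$-clique cover of $G$ is $f:\mathcal{K}(G)\to\mathbb{R}_{\ge0}$ with $\sum_{K\in\mathcal{K}(G),\,T\subseteq K}f(K)\ge1$ for every $T\in\mathcal{K}_t(G)$; a fractional $t$-clique decomposition is such an $f$ with equality for every $T\in\mathcal{K}_t(G)$. $\mathrm{cov}^*_t(G,\mathbf{c})$ and $\mathrm{dec}^*_t(G,\mathbf{c})$ denote the minimum $\mathbf{c}$-cost of a fractional $t$-clique cover and of a fractional $t$-clique decomposition of $G$, respectively. *)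

theory Defs
  imports "HOL-Analysis.Analysis" "HOL-Library.Disjoint_Sets" "Graph_Theory.Pair_Digraph"
begin

text \<open>
  Finite simple graphs are the \<open>pair_graph\<close>s of the \<open>Graph_Theory\<close> library: finite, loop-free,
  symmetric digraphs whose arcs are pairs of vertices, so that \<open>u\<close> and \<open>v\<close> are adjacent iff
  \<open>(u, v) \<in> parcs G\<close>.
\<close>

definition cliques :: "'a pair_pre_digraph \<Rightarrow> 'a set set" where
  "cliques G = {K. K \<noteq> {} \<and> K \<subseteq> pverts G \<and> (\<forall>u\<in>K. \<forall>v\<in>K. u \<noteq> v \<longrightarrow> (u, v) \<in> parcs G)}"

definition cliques_of_size :: "nat \<Rightarrow> 'a pair_pre_digraph \<Rightarrow> 'a set set" where
  "cliques_of_size t G = {K \<in> cliques G. card K = t}"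

text \<open>
  A function on the cliques of \<open>G\<close> is a total function \<open>'a set \<Rightarrow> real\<close>; its values on sets that
  are not cliques of \<open>G\<close> are irrelevant in everything below.
\<close>

definition clique_cost :: "'a pair_pre_digraph \<Rightarrow> (nat \<Rightarrow> real) \<Rightarrow> ('a set \<Rightarrow> real) \<Rightarrow> real" where
  "clique_cost G c f = (\<Sum>K\<in>cliques G. c (card K) * f K)"

definition frac_clique_cover :: "nat \<Rightarrow> 'a pair_pre_digraph \<Rightarrow> ('a set \<Rightarrow> real) \<Rightarrow> bool" where
  "frac_clique_cover t G f \<longleftrightarrow>
     (\<forall>K\<in>cliques G. 0 \<le> f K) \<and>
     (\<forall>T\<in>cliques_of_size t G. (\<Sum>K\<in>{K \<in> cliques G. T \<subseteq> K}. f K) \<ge> 1)"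

definition frac_clique_decomposition :: "nat \<Rightarrow> 'a pair_pre_digraph \<Rightarrow> ('a set \<Rightarrow> real) \<Rightarrow> bool" where
  "frac_clique_decomposition t G f \<longleftrightarrow>
     (\<forall>K\<in>cliques G. 0 \<le> f K) \<and>
     (\<forall>T\<in>cliques_of_size t G. (\<Sum>K\<in>{K \<in> cliques G. T \<subseteq> K}. f K) = 1)"

text \<open>
  Both are genuine minima, since the minimum is attained whenever \<open>c\<close> is nonnegative on the
  positive integers: see \<open>frac_cov_attained\<close> and \<open>frac_dec_attained\<close> below.
\<close>

definition frac_cov :: "nat \<Rightarrow> 'a pair_pre_digraph \<Rightarrow> (nat \<Rightarrow> real) \<Rightarrow> real" where
  "frac_cov t G c = (LEAST x. \<exists>f. frac_clique_cover t G f \<and> x = clique_cost G c f)"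

definition frac_dec :: "nat \<Rightarrow> 'a pair_pre_digraph \<Rightarrow> (nat \<Rightarrow> real) \<Rightarrow> real" where
  "frac_dec t G c = (LEAST x. \<exists>f. frac_clique_decomposition t G f \<and> x = clique_cost G c f)"

text \<open>
  The parts are nonempty; their number is arbitrary, so edgeless graphs (one part) and complete
  graphs (singleton parts) are included.
\<close>

definition complete_multipartite :: "'a pair_pre_digraph \<Rightarrow> bool" where
  "complete_multipartite H \<longleftrightarrow>
     pair_graph H \<and>
     (\<exists>P. partition_on (pverts H) P \<and>
        (\<forall>u\<in>pverts H. \<forall>v\<in>pverts H. (u, v) \<in> parcs H \<longleftrightarrow> \<not> (\<exists>A\<in>P. u \<in> A \<and> v \<in> A)))"

lemma finite_cliques:
  assumes "pair_graph G"
  shows "finite (cliques G)"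
proof -
  interpret pair_graph G by fact
  have "cliques G \<subseteq> Pow (pverts G)" by (auto simp: cliques_def)
  then show ?thesis using pair_finite_verts by (meson finite_Pow_iff finite_subset)
qed

lemma card_clique_ge_1:
  assumes "pair_graph G" "K \<in> cliques G"
  shows "card K \<ge> 1"
proof -
  interpret pair_graph G by fact
  have "finite K" "K \<noteq> {}"
    using assms(2) pair_finite_verts by (auto simp: cliques_def intro: finite_subset)
  then show ?thesis by (simp add: Suc_leI card_gt_0_iff)
qed

lemma box_attains_min:
  fixes cost :: "('b \<Rightarrow> real) \<Rightarrow> real"
  assumes cont: "continuous_on UNIV cost" and "closed {f. P f}"
    and nonempty: "P f0"
    and reduce: "\<And>f. P f \<Longrightarrow> \<exists>g. P g \<and> (\<forall>K. 0 \<le> g K \<and> g K \<le> 1) \<and> cost g \<le> cost f"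
  shows "\<exists>f. P f \<and> (\<forall>g. P g \<longrightarrow> cost f \<le> cost g)"
proof -
  define B :: "('b \<Rightarrow> real) set" where "B = PiE UNIV (\<lambda>_. {0..1})"
  have "compactin (product_topology (\<lambda>_. euclidean) UNIV) B"
    unfolding B_def by (subst compactin_PiE) auto
  then have "compact B" by (simp add: euclidean_product_topology)
  then have comp: "compact (B \<inter> {f. P f})" using assms(2) by (rule compact_Int_closed)
  have inB: "g \<in> B \<longleftrightarrow> (\<forall>K. 0 \<le> g K \<and> g K \<le> 1)" for g
    by (auto simp: B_def PiE_iff)
  have "B \<inter> {f. P f} \<noteq> {}" using reduce[OF nonempty] inB by blast
  then obtain f where f: "f \<in> B \<inter> {f. P f}" "\<And>g. g \<in> B \<inter> {f. P f} \<Longrightarrow> cost f \<le> cost g"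
    using continuous_attains_inf[OF comp _ continuous_on_subset[OF cont subset_UNIV]] by blast
  have "cost f \<le> cost g" if "P g" for g
  proof -
    obtain g' where "P g'" "\<forall>K. 0 \<le> g' K \<and> g' K \<le> 1" "cost g' \<le> cost g"
      using reduce[OF \<open>P g\<close>] by blast
    then have "cost f \<le> cost g'" by (intro f(2)) (simp add: inB)
    then show ?thesis using \<open>cost g' \<le> cost g\<close> by simp
  qed
  then show ?thesis using f(1) by blast
qed

lemma LEAST_attained:
  fixes cost :: "'b \<Rightarrow> real"
  assumes "\<exists>f. P f \<and> (\<forall>g. P g \<longrightarrow> cost f \<le> cost g)"
  shows "\<exists>f. P f \<and> cost f = (LEAST x. \<exists>f. P f \<and> x = cost f) \<and> (\<forall>g. P g \<longrightarrow> cost f \<le> cost g)"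
proof -
  obtain f where f: "P f" "\<And>g. P g \<Longrightarrow> cost f \<le> cost g" using assms by blast
  have "(LEAST x. \<exists>f. P f \<and> x = cost f) = cost f"
    by (rule Least_equality) (use f in auto)
  then show ?thesis using f by auto
qed

lemma continuous_on_clique_cost: "continuous_on UNIV (clique_cost G c)"
  unfolding clique_cost_def by (intro continuous_intros continuous_on_product_coordinates)

lemma closed_Collect_ball:
  assumes "\<And>x. x \<in> A \<Longrightarrow> closed {f. P x f}"
  shows "closed {f. \<forall>x\<in>A. P x f}"
proof -
  have "{f. \<forall>x\<in>A. P x f} = (\<Inter>x\<in>A. {f. P x f})" by auto
  then show ?thesis using assms by (simp add: closed_INT)
qed

lemma closed_frac_clique_cover: "closed {f. frac_clique_cover t G f}"
  unfolding frac_clique_cover_def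
  by (intro closed_Collect_conj closed_Collect_ball closed_Collect_le continuous_intros
      continuous_on_product_coordinates)

lemma closed_frac_clique_decomposition: "closed {f. frac_clique_decomposition t G f}"
  unfolding frac_clique_decomposition_def
  by (intro closed_Collect_conj closed_Collect_ball closed_Collect_le closed_Collect_eq
      continuous_intros continuous_on_product_coordinates)

lemma clique_cost_mono:
  assumes "pair_graph G" "\<And>i. i \<ge> 1 \<Longrightarrow> 0 \<le> c i" "\<And>K. K \<in> cliques G \<Longrightarrow> g K \<le> f K"
  shows "clique_cost G c g \<le> clique_cost G c f"
  unfolding clique_cost_def
  using assms card_clique_ge_1 by (intro sum_mono mult_left_mono) auto

theorem frac_cov_attained:
  assumes G: "pair_graph G" and c: "\<And>i. i \<ge> 1 \<Longrightarrow> 0 \<le> c i"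
  shows "\<exists>f. frac_clique_cover t G f \<and> clique_cost G c f = frac_cov t G c \<and>
    (\<forall>g. frac_clique_cover t G g \<longrightarrow> clique_cost G c f \<le> clique_cost G c g)"
  unfolding frac_cov_def
proof (intro LEAST_attained box_attains_min continuous_on_clique_cost closed_frac_clique_cover)
  note fin [simp] = finite_cliques[OF G]
  show "frac_clique_cover t G (\<lambda>_. 1)"
    unfolding frac_clique_cover_def
  proof (intro conjI ballI)
    fix T assume "T \<in> cliques_of_size t G"
    then have "{K \<in> cliques G. T \<subseteq> K} \<noteq> {}" by (auto simp: cliques_of_size_def)
    then show "(\<Sum>K\<in>{K \<in> cliques G. T \<subseteq> K}. 1::real) \<ge> 1"
      by (simp add: Suc_leI card_gt_0_iff del: Collect_empty_eq)
  qed auto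
  fix f assume f: "frac_clique_cover t G f"
  define g where "g = (\<lambda>K. if K \<in> cliques G then min (f K) 1 else 0)"
  have "frac_clique_cover t G g"
    unfolding frac_clique_cover_def
  proof (intro conjI ballI)
    fix K assume "K \<in> cliques G"
    then show "0 \<le> g K" using f by (auto simp: g_def frac_clique_cover_def)
  next
    fix T assume T: "T \<in> cliques_of_size t G"
    let ?A = "{K \<in> cliques G. T \<subseteq> K}"
    have g0: "0 \<le> g K" if "K \<in> ?A" for K using f that by (auto simp: g_def frac_clique_cover_def)
    show "(\<Sum>K\<in>?A. g K) \<ge> 1"
    proof (cases "\<exists>K\<in>?A. f K \<ge> 1")
      case True
      then obtain K where K: "K \<in> ?A" "f K \<ge> 1" by blast
      then have "1 = g K" by (auto simp: g_def)
      also have "\<dots> \<le> (\<Sum>K\<in>?A. g K)" using K g0 by (intro member_le_sum) auto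
      finally show ?thesis .
    next
      case False
      then have "(\<Sum>K\<in>?A. g K) = (\<Sum>K\<in>?A. f K)" by (intro sum.cong) (auto simp: g_def)
      then show ?thesis using f T by (simp add: frac_clique_cover_def)
    qed
  qed
  moreover have "\<forall>K. 0 \<le> g K \<and> g K \<le> 1" using f by (auto simp: g_def frac_clique_cover_def)
  moreover have "clique_cost G c g \<le> clique_cost G c f"
    by (intro clique_cost_mono G c) (auto simp: g_def)
  ultimately show "\<exists>g. frac_clique_cover t G g \<and> (\<forall>K. 0 \<le> g K \<and> g K \<le> 1) \<and>
      clique_cost G c g \<le> clique_cost G c f" by blast
qed

theorem frac_dec_attained:
  assumes G: "pair_graph G" and c: "\<And>i. i \<ge> 1 \<Longrightarrow> 0 \<le> c i"
  shows "\<exists>f. frac_clique_decomposition t G f \<and> clique_cost G c f = frac_dec t G c \<and>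
    (\<forall>g. frac_clique_decomposition t G g \<longrightarrow> clique_cost G c f \<le> clique_cost G c g)"
  unfolding frac_dec_def
proof (intro LEAST_attained box_attains_min continuous_on_clique_cost
    closed_frac_clique_decomposition)
  note fin [simp] = finite_cliques[OF G]
  have fin_clique: "finite K" if "K \<in> cliques G" for K
    using card_clique_ge_1[OF G that] by (metis card.infinite not_one_le_zero)
  define h :: "'a set \<Rightarrow> real" where "h = (\<lambda>K. if card K = t then 1 else 0)"
  show "frac_clique_decomposition t G h"
    unfolding frac_clique_decomposition_def
  proof (intro conjI ballI)
    fix T assume T: "T \<in> cliques_of_size t G"
    have "(\<Sum>K\<in>{K \<in> cliques G. T \<subseteq> K}. h K) = (\<Sum>K\<in>{T}. h K)"
      using T by (intro sum.mono_neutral_right)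
        (auto simp: cliques_of_size_def h_def dest: card_subset_eq[OF fin_clique])
    then show "(\<Sum>K\<in>{K \<in> cliques G. T \<subseteq> K}. h K) = 1"
      using T by (simp add: h_def cliques_of_size_def)
  qed (auto simp: h_def)
  fix f assume f: "frac_clique_decomposition t G f"
  define g where
    "g = (\<lambda>K. if K \<in> cliques G \<and> (\<exists>T\<in>cliques_of_size t G. T \<subseteq> K) then f K else 0)"
  have "frac_clique_decomposition t G g"
    unfolding frac_clique_decomposition_def
  proof (intro conjI ballI)
    fix K assume "K \<in> cliques G"
    then show "0 \<le> g K" using f by (auto simp: g_def frac_clique_decomposition_def)
  next
    fix T assume T: "T \<in> cliques_of_size t G"
    have "(\<Sum>K\<in>{K \<in> cliques G. T \<subseteq> K}. g K) = (\<Sum>K\<in>{K \<in> cliques G. T \<subseteq> K}. f K)"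
      using T by (intro sum.cong) (auto simp: g_def)
    then show "(\<Sum>K\<in>{K \<in> cliques G. T \<subseteq> K}. g K) = 1"
      using f T by (simp add: frac_clique_decomposition_def)
  qed
  moreover have "0 \<le> g K \<and> g K \<le> 1" for K
  proof (cases "K \<in> cliques G \<and> (\<exists>T\<in>cliques_of_size t G. T \<subseteq> K)")
    case True
    then obtain T where T: "K \<in> cliques G" "T \<in> cliques_of_size t G" "T \<subseteq> K" by blast
    have "f K \<le> (\<Sum>K\<in>{K \<in> cliques G. T \<subseteq> K}. f K)"
      using T f by (intro member_le_sum) (auto simp: frac_clique_decomposition_def)
    then show ?thesis using f T by (auto simp: g_def frac_clique_decomposition_def)
  qed (auto simp: g_def)
  moreover have "clique_cost G c g \<le> clique_cost G c f"
    using f by (intro clique_cost_mono G c) (auto simp: g_def frac_clique_decomposition_def)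
  ultimately show "\<exists>g. frac_clique_decomposition t G g \<and> (\<forall>K. 0 \<le> g K \<and> g K \<le> 1) \<and>
      clique_cost G c g \<le> clique_cost G c f" by blast
qed

end

theory Submission
  imports Defs
begin

text \<open>
  Linear programming duality provides a weighting \<open>w\<close> of the \<open>t\<close>-cliques of \<open>G\<close> of total weight
  \<open>frac_cov t G c\<close> (or \<open>frac_dec t G c\<close>) such that every clique \<open>K\<close> contains weight at most
  \<open>c (card K)\<close>. Pulling \<open>G\<close> back along a map \<open>\<phi>\<close> of the vertex set to itself, and \<open>w\<close> along with
  it, preserves this constraint, and the total weight becomes
  \<open>\<Sum>S. w S * (\<Prod>x\<in>S. card (\<phi> -` {x}))\<close>. As in the proof of the Motzkin--Straus theorem, this is linear
  in the fibre sizes of two nonadjacent vertices as long as their sum is fixed, so merging one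
  of the two fibres into the other, in the right direction, does not decrease it. Once the
  image of \<open>\<phi>\<close> is a clique, the pullback is complete multipartite.
\<close>

section \<open>Linear programming duality\<close>

text \<open>Bartl's inductive proof, which needs neither topology nor a dimension.\<close>

lemma farkas:
  fixes A :: "'i \<Rightarrow> 'j \<Rightarrow> real"
  assumes "finite I" and J: "finite J"
    and "\<And>y. (\<And>i. i \<in> I \<Longrightarrow> (\<Sum>j\<in>J. A i j * y j) \<le> 0) \<Longrightarrow> (\<Sum>j\<in>J. b j * y j) \<le> 0"
  shows "\<exists>l. (\<forall>i\<in>I. 0 \<le> l i) \<and> (\<forall>j\<in>J. b j = (\<Sum>i\<in>I. l i * A i j))"
  using assms(1,3)
proof (induction I arbitrary: A b rule: finite_induct)
  case empty
  \<comment> \<open>With no rows every \<open>y\<close> is admissible, in particular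
    \<open>y = b\<close>, which forces \<open>b\<close> to vanish on \<open>J\<close>.\<close>
  have "(\<Sum>j\<in>J. b j * b j) \<le> 0" by (rule empty) simp
  then have "(\<Sum>j\<in>J. b j * b j) = 0" by (simp add: antisym sum_nonneg)
  then show ?case using J by (simp add: sum_nonneg_eq_0_iff)
next
  case (insert k I)
  define ip where "ip a y = (\<Sum>j\<in>J. a j * y j)" for a y :: "'j \<Rightarrow> real"
  have ip_diff_left: "ip (\<lambda>j. a j - r * a' j) y = ip a y - r * ip a' y"
    and ip_diff_right: "ip a (\<lambda>j. y j - r * y' j) = ip a y - r * ip a y'"
    and ip_scale: "ip a (\<lambda>j. r * y j) = r * ip a y" for a a' y y' r
    by (simp_all add: ip_def algebra_simps sum_subtractf sum_distrib_left)
  note hyp = insert.prems[folded ip_def]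
  show ?case
  \<comment> \<open>If the rows in \<open>I\<close> alone imply the inequality for \<open>b\<close>,
    row \<open>k\<close> gets multiplier 0. Otherwise some \<open>z\<close> violates it, and only
    row \<open>k\<close> can exclude \<open>z\<close>.\<close>
  proof (cases "\<forall>y. (\<forall>i\<in>I. ip (A i) y \<le> 0) \<longrightarrow> ip b y \<le> 0")
    case True
    then obtain l where "\<forall>i\<in>I. 0 \<le> l i" "\<forall>j\<in>J. b j = (\<Sum>i\<in>I. l i * A i j)"
      using insert.IH[of A b, folded ip_def] by blast
    then show ?thesis using insert.hyps
      by (intro exI[of _ "l(k := 0)"]) (auto intro!: sum.cong)
  next
    case False
    then obtain z where z: "\<And>i. i \<in> I \<Longrightarrow> ip (A i) z \<le> 0" "ip b z > 0" by force
    then have kz: "ip (A k) z > 0" using hyp[of z] by force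
    define y0 where "y0 = (\<lambda>j. inverse (ip (A k) z) * z j)"
    have y0: "ip (A i) y0 \<le> 0" if "i \<in> I" for i
      using z(1)[OF that] kz by (simp add: y0_def ip_scale mult_nonneg_nonpos)
    have by0: "ip b y0 > 0" and ky0: "ip (A k) y0 = 1"
      using z(2) kz by (simp_all add: y0_def ip_scale)
    \<comment> \<open>Multiples of row \<open>k\<close> are subtracted so that all functionals
      vanish at \<open>y0\<close>. Their value at \<open>y\<close> is then the old value at the
      projection of \<open>y\<close> along \<open>y0\<close> to the kernel of row \<open>k\<close>,
      where the constraint of row \<open>k\<close> holds automatically.\<close>
    define A' where "A' = (\<lambda>i j. A i j - ip (A i) y0 * A k j)"
    define b' where "b' = (\<lambda>j. b j - ip b y0 * A k j)"
    have "ip b' y \<le> 0" if "\<And>i. i \<in> I \<Longrightarrow> ip (A' i) y \<le> 0" for y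
    proof -
      define y' where "y' = (\<lambda>j. y j - ip (A k) y * y0 j)"
      have Ay': "ip (A i) y' = ip (A' i) y" for i
        unfolding y'_def A'_def ip_diff_left ip_diff_right by simp
      have "ip (A k) y' = 0" by (simp add: y'_def ip_diff_right ky0)
      then have "ip b y' \<le> 0" using that by (intro hyp) (auto simp: Ay')
      then show ?thesis
        unfolding y'_def b'_def ip_diff_left ip_diff_right by (simp add: mult.commute)
    qed
    then obtain l where l: "\<forall>i\<in>I. 0 \<le> l i" "\<forall>j\<in>J. b' j = (\<Sum>i\<in>I. l i * A' i j)"
      using insert.IH[of A' b', folded ip_def] by blast
    \<comment> \<open>The total coefficient of row \<open>k\<close> once \<open>A'\<close> and
      \<open>b'\<close> are expanded.\<close>
    define r where "r = ip b y0 - (\<Sum>i\<in>I. l i * ip (A i) y0)"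
    have "(\<Sum>i\<in>I. l i * ip (A i) y0) \<le> 0"
      using l(1) y0 by (intro sum_nonpos) (simp add: mult_nonneg_nonpos)
    then have "0 \<le> r" using by0 by (simp add: r_def)
    moreover have "b j = r * A k j + (\<Sum>i\<in>I. l i * A i j)" if "j \<in> J" for j
      using l(2) that
      by (simp add: b'_def A'_def r_def algebra_simps sum_subtractf sum_distrib_left)
    moreover have "(\<Sum>i\<in>I. (l(k := r)) i * A i j) = (\<Sum>i\<in>I. l i * A i j)" for j
      using insert.hyps by (intro sum.cong) auto
    ultimately show ?thesis using l(1) insert.hyps
      by (intro exI[of _ "l(k := r)"]) auto
  qed
qed

text \<open>Farkas' lemma for the homogenised programme: with an extra variable \<open>z\<close>
  scaling the right-hand sides, \<open>A x >= b z\<close>, \<open>x >= 0\<close> and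
  \<open>z >= 0\<close> must imply \<open>p z <= c x\<close>. For \<open>z > 0\<close> divide by
  \<open>z\<close>; for \<open>z = 0\<close> the feasible point \<open>x0\<close> is needed.\<close>

lemma lp_duality_ge:
  fixes A :: "'i \<Rightarrow> 'j \<Rightarrow> real"
  assumes I: "finite I" and J: "finite J"
    and x0: "\<And>j. j \<in> J \<Longrightarrow> 0 \<le> x0 j" "\<And>i. i \<in> I \<Longrightarrow> (\<Sum>j\<in>J. A i j * x0 j) \<ge> b i"
    and opt: "\<And>x. (\<And>j. j \<in> J \<Longrightarrow> 0 \<le> x j) \<Longrightarrow> (\<And>i. i \<in> I \<Longrightarrow> (\<Sum>j\<in>J. A i j * x j) \<ge> b i) \<Longrightarrow>
      p \<le> (\<Sum>j\<in>J. c j * x j)"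
  shows "\<exists>y. (\<forall>i\<in>I. 0 \<le> y i) \<and> (\<forall>j\<in>J. (\<Sum>i\<in>I. y i * A i j) \<le> c j) \<and> p \<le> (\<Sum>i\<in>I. b i * y i)"
proof -
  \<comment> \<open>Column \<open>None\<close> carries the right-hand sides; rows \<open>Inr (Some j)\<close> and \<open>Inr None\<close> are the
    slacks of the dual constraints and of the objective.\<close>
  define M :: "'i + 'j option \<Rightarrow> 'j option \<Rightarrow> real" where
    "M = (\<lambda>r s. case r of Inl i \<Rightarrow> (case s of None \<Rightarrow> b i | Some j \<Rightarrow> A i j)
       | Inr None \<Rightarrow> (case s of None \<Rightarrow> -1 | Some j \<Rightarrow> 0)
       | Inr (Some j') \<Rightarrow> (case s of None \<Rightarrow> 0 | Some j \<Rightarrow> of_bool (j = j')))"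
  define d where "d = case_option p c"
  let ?J = "insert None (Some ` J)" and ?I = "I <+> insert None (Some ` J)"
  have split: "(\<Sum>s\<in>?J. g s) = g None + (\<Sum>j\<in>J. g (Some j))" for g :: "'j option \<Rightarrow> real"
    using J by (subst sum.insert) (auto simp: sum.reindex)
  have "\<exists>l. (\<forall>r\<in>?I. 0 \<le> l r) \<and> (\<forall>s\<in>?J. d s = (\<Sum>r\<in>?I. l r * M r s))"
  proof (rule farkas)
    fix y assume y: "\<And>r. r \<in> ?I \<Longrightarrow> (\<Sum>s\<in>?J. M r s * y s) \<le> 0"
    \<comment> \<open>The sign change turns the \<open><= 0\<close> form of Farkas' lemma into
      \<open>>=\<close> constraints.\<close>
    define x where "x = (\<lambda>j. - y (Some j))"
    define z where "z = y None"
    have z: "0 \<le> z" using y[of "Inr None"] by (simp add: split M_def z_def InrI)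
    have x: "0 \<le> x j" if "j \<in> J" for j
      using y[of "Inr (Some j)"] that J by (simp add: split M_def x_def InrI)
    have xz: "(\<Sum>j\<in>J. A i j * x j) \<ge> b i * z" if "i \<in> I" for i
      using y[of "Inl i"] that by (simp add: split M_def x_def z_def sum_negf InlI)
    have "p * z \<le> (\<Sum>j\<in>J. c j * x j)"
    proof (cases "z = 0")
      case False
      then have "p \<le> (\<Sum>j\<in>J. c j * (x j / z))"
        using x z xz by (intro opt) (auto simp: sum_divide_distrib[symmetric] field_simps)
      then show ?thesis using False z by (simp add: sum_divide_distrib[symmetric] field_simps)
    next
      case True
      show ?thesis
      proof (rule ccontr)
        define C where "C = (\<Sum>j\<in>J. c j * x j)"
        assume "\<not> ?thesis"
        then have "C < 0" using True by (simp add: C_def)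
        \<comment> \<open>As \<open>z = 0\<close>, \<open>x\<close> is a recession direction:
          \<open>x0 + q x\<close> stays feasible for every \<open>q >= 0\<close>. This
          \<open>q\<close> is large enough to push the cost below \<open>p\<close>.\<close>
        define q where "q = (\<bar>p - (\<Sum>j\<in>J. c j * x0 j)\<bar> + 1) / - C"
        have q: "0 \<le> q" "q * C = - (\<bar>p - (\<Sum>j\<in>J. c j * x0 j)\<bar> + 1)"
          using \<open>C < 0\<close> by (simp_all add: q_def divide_nonneg_neg)
        have lin: "(\<Sum>j\<in>J. a j * (x0 j + q * x j)) = (\<Sum>j\<in>J. a j * x0 j) + q * (\<Sum>j\<in>J. a j * x j)" for a
          by (simp add: algebra_simps sum.distrib sum_distrib_left)
        have "p \<le> (\<Sum>j\<in>J. c j * (x0 j + q * x j))"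
        proof (rule opt)
          show "0 \<le> x0 j + q * x j" if "j \<in> J" for j using x x0(1) q(1) that by simp
          show "(\<Sum>j\<in>J. A i j * (x0 j + q * x j)) \<ge> b i" if "i \<in> I" for i
          proof -
            have "0 \<le> q * (\<Sum>j\<in>J. A i j * x j)" using xz[OF that] q(1) True by simp
            then show ?thesis using x0(2)[OF that] unfolding lin by linarith
          qed
        qed
        then show False unfolding lin C_def[symmetric] q(2) by linarith
      qed
    qed
    then show "(\<Sum>s\<in>?J. d s * y s) \<le> 0" by (simp add: split d_def x_def z_def sum_negf)
  qed (use I J in auto)
  then obtain l where "\<forall>r\<in>?I. 0 \<le> l r" "\<forall>s\<in>?J. d s = (\<Sum>r\<in>?I. l r * M r s)"
    by (elim exE conjE)
  note l = this[rule_format]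
  have row: "(\<Sum>r\<in>?I. l r * M r s) = (\<Sum>i\<in>I. l (Inl i) * M (Inl i) s) + l (Inr None) * M (Inr None) s
      + (\<Sum>j\<in>J. l (Inr (Some j)) * M (Inr (Some j)) s)" for s
    using I J by (subst sum.Plus) (auto simp: split)
  define y where "y = l \<circ> Inl"
  have "(\<Sum>i\<in>I. y i * A i j) \<le> c j" if "j \<in> J" for j
  proof -
    have "(\<Sum>j'\<in>J. l (Inr (Some j')) * of_bool (j = j')) \<ge> 0"
      using l(1) by (intro sum_nonneg) auto
    then show ?thesis using l(2)[of "Some j"] that unfolding row by (simp add: M_def d_def y_def)
  qed
  moreover have "p \<le> (\<Sum>i\<in>I. b i * y i)"
    using l(2)[of None] l(1)[of "Inr None"] unfolding row
    by (auto simp: M_def d_def y_def mult.commute)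
  moreover have "\<forall>i\<in>I. 0 \<le> y i" using l(1) by (auto simp: y_def)
  ultimately show ?thesis by blast
qed

text \<open>Each equality in \<open>E\<close> is split into two opposite inequalities. The
  difference of their two multipliers is the dual variable, so it has no prescribed sign.\<close>

lemma lp_duality:
  fixes A :: "'i \<Rightarrow> 'j \<Rightarrow> real"
  assumes I: "finite I" and J: "finite J" and E: "E \<subseteq> I"
    and x0: "\<And>j. j \<in> J \<Longrightarrow> 0 \<le> x0 j" "\<And>i. i \<in> I \<Longrightarrow> (\<Sum>j\<in>J. A i j * x0 j) \<ge> b i"
      "\<And>i. i \<in> E \<Longrightarrow> (\<Sum>j\<in>J. A i j * x0 j) = b i"
    and opt: "\<And>x. (\<And>j. j \<in> J \<Longrightarrow> 0 \<le> x j) \<Longrightarrow> (\<And>i. i \<in> I \<Longrightarrow> (\<Sum>j\<in>J. A i j * x j) \<ge> b i) \<Longrightarrow>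
      (\<And>i. i \<in> E \<Longrightarrow> (\<Sum>j\<in>J. A i j * x j) = b i) \<Longrightarrow> p \<le> (\<Sum>j\<in>J. c j * x j)"
  shows "\<exists>y. (\<forall>i\<in>I - E. 0 \<le> y i) \<and> (\<forall>j\<in>J. (\<Sum>i\<in>I. y i * A i j) \<le> c j) \<and> p \<le> (\<Sum>i\<in>I. b i * y i)"
proof -
  have finE: "finite E" using E I by (rule finite_subset)
  let ?A = "case_sum A (\<lambda>i j. - A i j)" and ?b = "case_sum b (\<lambda>i. - b i)"
  have "\<exists>y. (\<forall>i\<in>I <+> E. 0 \<le> y i) \<and> (\<forall>j\<in>J. (\<Sum>i\<in>I <+> E. y i * ?A i j) \<le> c j) \<and>
      p \<le> (\<Sum>i\<in>I <+> E. ?b i * y i)"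
  proof (rule lp_duality_ge)
    show "(\<Sum>j\<in>J. ?A i j * x0 j) \<ge> ?b i" if "i \<in> I <+> E" for i
      using that x0 by (auto simp: sum_negf)
    fix x assume x: "\<And>j. j \<in> J \<Longrightarrow> 0 \<le> x j" "\<And>i. i \<in> I <+> E \<Longrightarrow> (\<Sum>j\<in>J. ?A i j * x j) \<ge> ?b i"
    show "p \<le> (\<Sum>j\<in>J. c j * x j)"
    proof (rule opt)
      show ge: "(\<Sum>j\<in>J. A i j * x j) \<ge> b i" if "i \<in> I" for i using x(2)[of "Inl i"] that by auto
      show "(\<Sum>j\<in>J. A i j * x j) = b i" if "i \<in> E" for i
        using x(2)[OF InrI[OF that]] ge[of i] that E by (auto simp: sum_negf)
    qed (fact x(1))
  qed (use I J finE x0(1) in auto)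
  then obtain y where y: "\<forall>i\<in>I <+> E. 0 \<le> y i"
    "\<forall>j\<in>J. (\<Sum>i\<in>I <+> E. y i * ?A i j) \<le> c j" "p \<le> (\<Sum>i\<in>I <+> E. ?b i * y i)"
    by (elim exE conjE)
  define y' where "y' = (\<lambda>i. y (Inl i) - (if i \<in> E then y (Inr i) else 0))"
  have y': "(\<Sum>i\<in>I. y' i * g i) = (\<Sum>i\<in>I <+> E. y i * case_sum g (\<lambda>i. - g i) i)" for g
  proof -
    have "(\<Sum>i\<in>I. y' i * g i) = (\<Sum>i\<in>I. y (Inl i) * g i) - (\<Sum>i\<in>I. if i \<in> E then y (Inr i) * g i else 0)"
      unfolding sum_subtractf[symmetric] by (intro sum.cong) (auto simp: y'_def algebra_simps)
    also have "(\<Sum>i\<in>I. if i \<in> E then y (Inr i) * g i else 0) = (\<Sum>i\<in>E. y (Inr i) * g i)"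
      using I E by (simp add: sum.inter_restrict[symmetric] Int_absorb1)
    finally show ?thesis using I finE by (simp add: sum.Plus sum_negf)
  qed
  show ?thesis
  proof (intro exI[of _ y'] conjI ballI)
    show "0 \<le> y' i" if "i \<in> I - E" for i using y(1) that by (auto simp: y'_def)
    show "(\<Sum>i\<in>I. y' i * A i j) \<le> c j" if "j \<in> J" for j
    proof -
      have "case_sum (\<lambda>i. A i j) (\<lambda>i. - A i j) r = ?A r j" for r by (cases r) auto
      then show ?thesis using y(2)[rule_format, OF that] y'[of "\<lambda>i. A i j"] by simp
    qed
    show "p \<le> (\<Sum>i\<in>I. b i * y' i)" using y(3) y'[of b] by (simp add: mult.commute)
  qed
qed

section \<open>Dual weights on cliques\<close>

text \<open>The dual constraints common to covers and decompositions. Nonnegativity of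
  \<open>w\<close> belongs to covers only and is stated separately.\<close>

definition clique_dual :: "nat \<Rightarrow> 'a pair_pre_digraph \<Rightarrow> (nat \<Rightarrow> real) \<Rightarrow> ('a set \<Rightarrow> real) \<Rightarrow> bool" where
  "clique_dual t G c w \<longleftrightarrow>
     (\<forall>K\<in>cliques G. (\<Sum>T\<in>{T \<in> cliques_of_size t G. T \<subseteq> K}. w T) \<le> c (card K))"

lemma finite_cliques_of_size: "pair_graph G \<Longrightarrow> finite (cliques_of_size t G)"
  by (simp add: cliques_of_size_def finite_cliques)

text \<open>Double counting of pairs of a \<open>t\<close>-clique inside a clique. The factor
  \<open>w T\<close> in the last hypothesis lets it serve both covers, with \<open>w T >= 0\<close>,
  and decompositions, with \<open>w T\<close> of any sign.\<close>

lemma clique_dual_weak_duality: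
  assumes G: "pair_graph G" and dual: "clique_dual t G c w"
    and f: "\<And>K. K \<in> cliques G \<Longrightarrow> 0 \<le> f K"
    and le: "\<And>T. T \<in> cliques_of_size t G \<Longrightarrow> w T \<le> w T * (\<Sum>K\<in>{K \<in> cliques G. T \<subseteq> K}. f K)"
  shows "(\<Sum>T\<in>cliques_of_size t G. w T) \<le> clique_cost G c f"
proof -
  note [simp] = finite_cliques[OF G] finite_cliques_of_size[OF G]
  have "(\<Sum>T\<in>cliques_of_size t G. w T)
      \<le> (\<Sum>T\<in>cliques_of_size t G. w T * (\<Sum>K\<in>cliques G. of_bool (T \<subseteq> K) * f K))"
    using le by (intro sum_mono) (simp add: Collect_conj_eq)
  also have "\<dots> = (\<Sum>K\<in>cliques G. f K * (\<Sum>T\<in>cliques_of_size t G. of_bool (T \<subseteq> K) * w T))"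
    unfolding sum_distrib_left by (subst sum.swap) (intro sum.cong; simp)
  also have "\<dots> \<le> (\<Sum>K\<in>cliques G. f K * c (card K))"
    using dual f by (intro sum_mono mult_left_mono) (auto simp: Collect_conj_eq clique_dual_def)
  finally show ?thesis by (simp add: clique_cost_def mult.commute)
qed

lemma frac_cov_ge_dual:
  assumes G: "pair_graph G" and c: "\<And>i. i \<ge> 1 \<Longrightarrow> 0 \<le> c i"
    and dual: "clique_dual t G c w" and w: "\<And>T. T \<in> cliques_of_size t G \<Longrightarrow> 0 \<le> w T"
  shows "(\<Sum>T\<in>cliques_of_size t G. w T) \<le> frac_cov t G c"
proof -
  obtain f where f: "frac_clique_cover t G f" "clique_cost G c f = frac_cov t G c"
    using frac_cov_attained[where c = c, OF G c] by blast
  have "w T \<le> w T * (\<Sum>K\<in>{K \<in> cliques G. T \<subseteq> K}. f K)" if "T \<in> cliques_of_size t G" for T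
    using mult_left_mono[of 1 "\<Sum>K\<in>{K \<in> cliques G. T \<subseteq> K}. f K" "w T"] f(1) w that
    by (simp add: frac_clique_cover_def)
  then show ?thesis
    using clique_dual_weak_duality[OF G dual] f by (metis frac_clique_cover_def)
qed

lemma frac_dec_ge_dual:
  assumes G: "pair_graph G" and c: "\<And>i. i \<ge> 1 \<Longrightarrow> 0 \<le> c i" and dual: "clique_dual t G c w"
  shows "(\<Sum>T\<in>cliques_of_size t G. w T) \<le> frac_dec t G c"
proof -
  obtain f where f: "frac_clique_decomposition t G f" "clique_cost G c f = frac_dec t G c"
    using frac_dec_attained[where c = c, OF G c] by blast
  then show ?thesis
    using clique_dual_weak_duality[OF G dual, of f] by (simp add: frac_clique_decomposition_def)
qed

text \<open>Strong duality for the containment matrix of \<open>t\<close>-cliques in cliques, with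
  no equality rows. An optimal cover serves as the feasible point and its minimality as the bound
  \<open>p\<close>.\<close>

lemma frac_cov_dual_exists:
  assumes G: "pair_graph G" and c: "\<And>i. i \<ge> 1 \<Longrightarrow> 0 \<le> c i"
  obtains w where "clique_dual t G c w" "\<And>T. T \<in> cliques_of_size t G \<Longrightarrow> 0 \<le> w T"
    "frac_cov t G c \<le> (\<Sum>T\<in>cliques_of_size t G. w T)"
proof -
  note fin [simp] = finite_cliques[OF G] finite_cliques_of_size[OF G]
  obtain f where f: "frac_clique_cover t G f"
    "\<And>g. frac_clique_cover t G g \<Longrightarrow> frac_cov t G c \<le> clique_cost G c g"
    using frac_cov_attained[where c = c, OF G c] by metis
  have "\<exists>w. (\<forall>T\<in>cliques_of_size t G - {}. 0 \<le> w T) \<and>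
      (\<forall>K\<in>cliques G. (\<Sum>T\<in>cliques_of_size t G. w T * of_bool (T \<subseteq> K)) \<le> c (card K)) \<and>
      frac_cov t G c \<le> (\<Sum>T\<in>cliques_of_size t G. 1 * w T)"
    by (rule lp_duality[where ?x0.0 = f])
      (use f in \<open>auto simp: Collect_conj_eq frac_clique_cover_def clique_cost_def\<close>)
  then show thesis using that by (auto simp: Collect_conj_eq clique_dual_def)
qed

text \<open>The same matrix, but now every row is an equality, so \<open>w\<close> may take negative
  values.\<close>

lemma frac_dec_dual_exists:
  assumes G: "pair_graph G" and c: "\<And>i. i \<ge> 1 \<Longrightarrow> 0 \<le> c i"
  obtains w where "clique_dual t G c w" "frac_dec t G c \<le> (\<Sum>T\<in>cliques_of_size t G. w T)"
proof -
  note fin [simp] = finite_cliques[OF G] finite_cliques_of_size[OF G]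
  obtain f where f: "frac_clique_decomposition t G f"
    "\<And>g. frac_clique_decomposition t G g \<Longrightarrow> frac_dec t G c \<le> clique_cost G c g"
    using frac_dec_attained[where c = c, OF G c] by metis
  have "\<exists>w. (\<forall>T\<in>cliques_of_size t G - cliques_of_size t G. 0 \<le> w T) \<and>
      (\<forall>K\<in>cliques G. (\<Sum>T\<in>cliques_of_size t G. w T * of_bool (T \<subseteq> K)) \<le> c (card K)) \<and>
      frac_dec t G c \<le> (\<Sum>T\<in>cliques_of_size t G. 1 * w T)"
    by (rule lp_duality[where ?x0.0 = f])
      (use f in \<open>auto simp: Collect_conj_eq frac_clique_decomposition_def clique_cost_def\<close>)
  then show thesis using that by (auto simp: Collect_conj_eq clique_dual_def)
qed

section \<open>Pulling back along a map of the vertices\<close>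

text \<open>A blow-up of \<open>G\<close> in which each vertex is replaced by its fibre, possibly
  empty. Using a self-map of the vertex set keeps the number of vertices fixed.\<close>

definition pullback_graph :: "('a \<Rightarrow> 'a) \<Rightarrow> 'a pair_pre_digraph \<Rightarrow> 'a pair_pre_digraph" where
  "pullback_graph \<phi> G = \<lparr>pverts = pverts G,
     parcs = {(u, v). u \<in> pverts G \<and> v \<in> pverts G \<and> (\<phi> u, \<phi> v) \<in> parcs G}\<rparr>"

lemma pverts_pullback_graph [simp]: "pverts (pullback_graph \<phi> G) = pverts G"
  by (simp add: pullback_graph_def)

lemma pair_graphD:
  assumes "pair_graph G"
  shows "finite (pverts G)" "(u, v) \<in> parcs G \<Longrightarrow> u \<in> pverts G \<and> v \<in> pverts G"
    "(u, u) \<notin> parcs G" "(u, v) \<in> parcs G \<Longrightarrow> (v, u) \<in> parcs G"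
proof -
  interpret pair_graph G by fact
  show "finite (pverts G)" by (rule pair_finite_verts)
  show "(u, v) \<in> parcs G \<Longrightarrow> u \<in> pverts G \<and> v \<in> pverts G" using in_arcsD1 in_arcsD2 by blast
  show "(u, u) \<notin> parcs G" using pair_no_loops by force
  show "(u, v) \<in> parcs G \<Longrightarrow> (v, u) \<in> parcs G" using arcs_symmetric by blast
qed

lemma pair_graph_pullback_graph:
  assumes G: "pair_graph G"
  shows "pair_graph (pullback_graph \<phi> G)"
proof
  note D = pair_graphD[OF G]
  show "finite (pverts (pullback_graph \<phi> G))" using D(1) by simp
  have "parcs (pullback_graph \<phi> G) \<subseteq> pverts G \<times> pverts G" by (auto simp: pullback_graph_def)
  then show "finite (parcs (pullback_graph \<phi> G))" using D(1) by (meson finite_SigmaI finite_subset)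
  show "symmetric (pullback_graph \<phi> G)"
    using D(4) by (auto simp: symmetric_def sym_def pullback_graph_def arcs_ends_def arc_to_ends_def)
qed (use pair_graphD[OF G] in \<open>auto simp: pullback_graph_def\<close>)

text \<open>As \<open>G\<close> has no loops, each fibre is independent, so a clique meets it at
  most once.\<close>

lemma cliques_pullback_graph:
  assumes G: "pair_graph G" and \<phi>: "\<phi> \<in> pverts G \<rightarrow> pverts G"
  shows "K \<in> cliques (pullback_graph \<phi> G) \<longleftrightarrow> K \<subseteq> pverts G \<and> inj_on \<phi> K \<and> \<phi> ` K \<in> cliques G"
  using \<phi> pair_graphD(3)[OF G]
  by (force simp: cliques_def pullback_graph_def inj_on_def subset_iff)

lemma cliques_of_size_pullback_graph:
  assumes "pair_graph G" and "\<phi> \<in> pverts G \<rightarrow> pverts G"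
  shows "T \<in> cliques_of_size t (pullback_graph \<phi> G) \<longleftrightarrow>
    T \<subseteq> pverts G \<and> inj_on \<phi> T \<and> \<phi> ` T \<in> cliques_of_size t G"
  using cliques_pullback_graph[OF assms] by (auto simp: cliques_of_size_def card_image)

text \<open>Taking images under \<open>\<phi>\<close>, which is injective on a clique
  \<open>K\<close>, matches the \<open>t\<close>-cliques inside \<open>K\<close> with those inside
  its image. The image has the same size, so the constraint at \<open>K\<close> is the original one
  at the image.\<close>

lemma clique_dual_pullback:
  assumes G: "pair_graph G" and \<phi>: "\<phi> \<in> pverts G \<rightarrow> pverts G" and dual: "clique_dual t G c w"
  shows "clique_dual t (pullback_graph \<phi> G) c (\<lambda>T. w (\<phi> ` T))"
  unfolding clique_dual_def
proof
  note cl = cliques_pullback_graph[OF G \<phi>] cliques_of_size_pullback_graph[OF G \<phi>]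
  fix K assume "K \<in> cliques (pullback_graph \<phi> G)"
  then have K: "K \<subseteq> pverts G" "inj_on \<phi> K" "\<phi> ` K \<in> cliques G" by (auto simp: cl)
  have "bij_betw ((`) \<phi>) {T \<in> cliques_of_size t (pullback_graph \<phi> G). T \<subseteq> K}
      {S \<in> cliques_of_size t G. S \<subseteq> \<phi> ` K}"
  proof (rule bij_betw_imageI)
    show "inj_on ((`) \<phi>) {T \<in> cliques_of_size t (pullback_graph \<phi> G). T \<subseteq> K}"
      by (rule inj_on_subset[OF inj_on_image_Pow[OF K(2)]]) auto
    show "(`) \<phi> ` {T \<in> cliques_of_size t (pullback_graph \<phi> G). T \<subseteq> K}
        = {S \<in> cliques_of_size t G. S \<subseteq> \<phi> ` K}"
      using K(1) inj_on_subset[OF K(2)] by (fastforce simp: cl subset_image_iff)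
  qed
  then have "(\<Sum>T\<in>{T \<in> cliques_of_size t (pullback_graph \<phi> G). T \<subseteq> K}. w (\<phi> ` T))
      = (\<Sum>S\<in>{S \<in> cliques_of_size t G. S \<subseteq> \<phi> ` K}. w S)"
    by (rule sum.reindex_bij_betw)
  also have "\<dots> \<le> c (card (\<phi> ` K))" using dual K(3) by (simp add: clique_dual_def)
  finally show "(\<Sum>T\<in>{T \<in> cliques_of_size t (pullback_graph \<phi> G). T \<subseteq> K}. w (\<phi> ` T)) \<le> c (card K)"
    using K(2) by (simp add: card_image)
qed

text \<open>The sets counted are the transversals of the fibres over \<open>S\<close>, that is, the
  images of sections of \<open>\<phi>\<close> over \<open>S\<close>.\<close>

lemma card_injective_lifts:
  assumes S: "finite S"
  shows "card {T. T \<subseteq> V \<and> inj_on \<phi> T \<and> \<phi> ` T = S} = (\<Prod>x\<in>S. card {p \<in> V. \<phi> p = x})"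
proof -
  have "bij_betw (\<lambda>f. f ` S) (\<Pi>\<^sub>E x\<in>S. {p \<in> V. \<phi> p = x}) {T. T \<subseteq> V \<and> inj_on \<phi> T \<and> \<phi> ` T = S}"
  proof (rule bij_betw_imageI)
    show "inj_on (\<lambda>f. f ` S) (\<Pi>\<^sub>E x\<in>S. {p \<in> V. \<phi> p = x})"
    proof (rule inj_onI)
      fix f g assume f: "f \<in> (\<Pi>\<^sub>E x\<in>S. {p \<in> V. \<phi> p = x})" and g: "g \<in> (\<Pi>\<^sub>E x\<in>S. {p \<in> V. \<phi> p = x})"
        and eq: "f ` S = g ` S"
      show "f = g"
      proof (rule PiE_ext[OF f g])
        fix x assume x: "x \<in> S"
        then obtain y where y: "y \<in> S" "f x = g y" using eq by blast
        have "\<phi> (f x) = x" "\<phi> (g y) = y" using f g x y(1) by (auto simp: PiE_iff)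
        then show "f x = g x" using y(2) by simp
      qed
    qed
    show "(\<lambda>f. f ` S) ` (\<Pi>\<^sub>E x\<in>S. {p \<in> V. \<phi> p = x}) = {T. T \<subseteq> V \<and> inj_on \<phi> T \<and> \<phi> ` T = S}"
    proof (intro subset_antisym subsetI)
      fix T assume "T \<in> (\<lambda>f. f ` S) ` (\<Pi>\<^sub>E x\<in>S. {p \<in> V. \<phi> p = x})"
      then obtain f where T: "T = f ` S" and f: "\<And>x. x \<in> S \<Longrightarrow> f x \<in> V \<and> \<phi> (f x) = x"
        by (auto simp: PiE_iff)
      then show "T \<in> {T. T \<subseteq> V \<and> inj_on \<phi> T \<and> \<phi> ` T = S}"
        by (auto simp: inj_on_def image_image)
    next
      fix T assume "T \<in> {T. T \<subseteq> V \<and> inj_on \<phi> T \<and> \<phi> ` T = S}"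
      then have T: "T \<subseteq> V" "inj_on \<phi> T" "\<phi> ` T = S" by auto
      have "the_inv_into T \<phi> x \<in> {p \<in> V. \<phi> p = x}" if "x \<in> S" for x
        using that T the_inv_into_into[OF T(2), of x T] f_the_inv_into_f[OF T(2), of x] by blast
      then have "restrict (the_inv_into T \<phi>) S \<in> (\<Pi>\<^sub>E x\<in>S. {p \<in> V. \<phi> p = x})"
        by (intro PiE_I) auto
      moreover have "restrict (the_inv_into T \<phi>) S ` S = T"
        unfolding image_restrict_eq using the_inv_into_onto[OF T(2)] T(3) by simp
      ultimately show "T \<in> (\<lambda>f. f ` S) ` (\<Pi>\<^sub>E x\<in>S. {p \<in> V. \<phi> p = x})"
        by (intro image_eqI[where x = "restrict (the_inv_into T \<phi>) S"]) simp_all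
    qed
  qed
  then show ?thesis using S by (simp add: bij_betw_same_card[symmetric] card_PiE)
qed

text \<open>The Lagrangian polynomial of the \<open>t\<close>-uniform hypergraph of
  \<open>t\<close>-cliques weighted by \<open>w\<close>.\<close>

definition blowup_weight :: "nat \<Rightarrow> 'a pair_pre_digraph \<Rightarrow> ('a set \<Rightarrow> real) \<Rightarrow> ('a \<Rightarrow> real) \<Rightarrow> real" where
  "blowup_weight t G w m = (\<Sum>S\<in>cliques_of_size t G. w S * (\<Prod>x\<in>S. m x))"

definition fibre_size :: "'a pair_pre_digraph \<Rightarrow> ('a \<Rightarrow> 'a) \<Rightarrow> 'a \<Rightarrow> real" where
  "fibre_size G \<phi> x = card {p \<in> pverts G. \<phi> p = x}"

text \<open>Group the \<open>t\<close>-cliques of the pullback by their image \<open>S\<close>; the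
  lifts of \<open>S\<close> are counted by the product of its fibre sizes.\<close>

lemma sum_dual_pullback:
  assumes G: "pair_graph G" and \<phi>: "\<phi> \<in> pverts G \<rightarrow> pverts G"
  shows "(\<Sum>T\<in>cliques_of_size t (pullback_graph \<phi> G). w (\<phi> ` T))
    = blowup_weight t G w (fibre_size G \<phi>)"
proof -
  note cl = cliques_of_size_pullback_graph[OF G \<phi>]
  let ?C = "cliques_of_size t (pullback_graph \<phi> G)"
  have "(\<Sum>T\<in>{T \<in> ?C. \<phi> ` T = S}. w (\<phi> ` T)) = w S * (\<Prod>x\<in>S. fibre_size G \<phi> x)"
    if S: "S \<in> cliques_of_size t G" for S
  proof -
    have "finite S"
      using S pair_graphD(1)[OF G] by (auto simp: cliques_of_size_def cliques_def intro: finite_subset)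
    moreover have "{T \<in> ?C. \<phi> ` T = S} = {T. T \<subseteq> pverts G \<and> inj_on \<phi> T \<and> \<phi> ` T = S}"
      using S by (auto simp: cl)
    ultimately show ?thesis by (simp add: card_injective_lifts fibre_size_def)
  qed
  then have "blowup_weight t G w (fibre_size G \<phi>)
      = (\<Sum>S\<in>cliques_of_size t G. \<Sum>T\<in>{T \<in> ?C. \<phi> ` T = S}. w (\<phi> ` T))"
    by (simp only: blowup_weight_def cong: sum.cong)
  also have "\<dots> = (\<Sum>T\<in>?C. w (\<phi> ` T))"
    by (rule sum.group)
      (use G in \<open>auto simp: cl finite_cliques_of_size pair_graph_pullback_graph\<close>)
  finally show ?thesis by simp
qed

section \<open>Merging nonadjacent fibres\<close>

text \<open>The product contains at most one of the factors \<open>m u\<close> and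
  \<open>m v\<close>, so it is affine along the segment on which their sum is constant. This is
  interpolation between the two endpoints of that segment, multiplied through by
  \<open>m u + m v\<close>.\<close>

lemma prod_shift_mass:
  fixes m :: "'a \<Rightarrow> real"
  assumes "finite S" and "u \<noteq> v" and "u \<notin> S \<or> v \<notin> S"
  shows "(m u + m v) * prod m S
    = m v * prod (m(u := 0, v := m u + m v)) S + m u * prod (m(v := 0, u := m u + m v)) S"
proof -
  have upd: "prod (m(a := r, b := q)) S = q * prod m (S - {b})" if "b \<in> S" "a \<notin> S" for a b r q
  proof -
    have "prod (m(a := r, b := q)) (S - {b}) = prod m (S - {b})"
      using that by (intro prod.cong) auto
    then show ?thesis using that \<open>finite S\<close> by (simp add: prod.remove[of S b])
  qed
  have zero: "prod (m(a := 0, b := q)) S = 0" if "a \<in> S" "a \<noteq> b" for a b q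
    using that \<open>finite S\<close> by (intro prod_zero) (auto intro: bexI[of _ a])
  consider "u \<in> S" "v \<notin> S" | "u \<notin> S" "v \<in> S" | "u \<notin> S" "v \<notin> S" using assms(3) by blast
  then show ?thesis
  proof cases
    case 1
    show ?thesis
      unfolding upd[OF 1] zero[OF 1(1) assms(2)] prod.remove[where g = m, OF assms(1) 1(1)]
      by (simp add: algebra_simps)
  next
    case 2
    show ?thesis
      unfolding upd[OF 2(2,1)] zero[OF 2(2) assms(2)[symmetric]] prod.remove[where g = m, OF assms(1) 2(2)]
      by (simp add: algebra_simps)
  next
    case 3
    then have "prod (m(u := r, v := q)) S = prod m S" "prod (m(v := r, u := q)) S = prod m S" for r q
      by (auto intro!: prod.cong)
    then show ?thesis by (simp add: algebra_simps)
  qed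
qed

text \<open>No clique contains both \<open>u\<close> and \<open>v\<close>, so summing the
  interpolation over all \<open>t\<close>-cliques makes the value at \<open>m\<close> a weighted
  average of the two endpoint values. This holds for \<open>w\<close> of either sign, as
  decompositions require.\<close>

lemma blowup_weight_shift_mass:
  assumes G: "pair_graph G" and "u \<noteq> v" and uv: "(u, v) \<notin> parcs G"
    and m: "0 < m u" "0 < m v"
  shows "blowup_weight t G w m \<le> blowup_weight t G w (m(u := 0, v := m u + m v)) \<or>
    blowup_weight t G w m \<le> blowup_weight t G w (m(v := 0, u := m u + m v))"
    (is "?F \<le> ?F1 \<or> ?F \<le> ?F2")
proof (rule ccontr)
  have S: "finite S" "u \<notin> S \<or> v \<notin> S" if "S \<in> cliques_of_size t G" for S
    using that pair_graphD(1)[OF G] uv \<open>u \<noteq> v\<close>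
    by (auto simp: cliques_of_size_def cliques_def intro: finite_subset)
  have "(m u + m v) * ?F = (\<Sum>S\<in>cliques_of_size t G. w S * ((m u + m v) * prod m S))"
    by (simp add: blowup_weight_def sum_distrib_left mult.left_commute)
  also have "\<dots> = (\<Sum>S\<in>cliques_of_size t G.
      w S * (m v * prod (m(u := 0, v := m u + m v)) S + m u * prod (m(v := 0, u := m u + m v)) S))"
    using S \<open>u \<noteq> v\<close> by (intro sum.cong refl arg_cong[where f = "(*) _"] prod_shift_mass)
  also have "\<dots> = m v * ?F1 + m u * ?F2"
    by (simp add: blowup_weight_def sum_distrib_left mult.left_commute distrib_left sum.distrib)
  finally have eq: "(m u + m v) * ?F = m v * ?F1 + m u * ?F2" .
  assume "\<not> ?thesis"
  then have "m v * ?F1 < m v * ?F" "m u * ?F2 < m u * ?F" using m by auto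
  then show False using eq by (simp add: distrib_right)
qed

lemma fibre_size_merge:
  assumes "pair_graph G" and "u \<noteq> v"
  shows "fibre_size G (\<lambda>p. if \<phi> p = u then v else \<phi> p)
    = (fibre_size G \<phi>)(u := 0, v := fibre_size G \<phi> u + fibre_size G \<phi> v)" (is "fibre_size G ?\<psi> = ?m")
proof
  fix x
  have "{p \<in> pverts G. ?\<psi> p = v} = {p \<in> pverts G. \<phi> p = u} \<union> {p \<in> pverts G. \<phi> p = v}"
    "{p \<in> pverts G. \<phi> p = u} \<inter> {p \<in> pverts G. \<phi> p = v} = {}"
    using assms(2) by auto
  then have "fibre_size G ?\<psi> v = fibre_size G \<phi> u + fibre_size G \<phi> v"
    using pair_graphD(1)[OF assms(1)] by (simp add: fibre_size_def card_Un_disjoint)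
  moreover have "{p \<in> pverts G. ?\<psi> p = u} = {}" using assms(2) by auto
  then have "fibre_size G ?\<psi> u = 0" by (simp only: fibre_size_def card.empty of_nat_0)
  moreover have "{p \<in> pverts G. ?\<psi> p = x} = {p \<in> pverts G. \<phi> p = x}" if "x \<noteq> u" "x \<noteq> v"
    using that by auto
  then have "fibre_size G ?\<psi> x = fibre_size G \<phi> x" if "x \<noteq> u" "x \<noteq> v"
    using that by (simp only: fibre_size_def simp_thms)
  ultimately show "fibre_size G ?\<psi> x = ?m x" by auto
qed

text \<open>Induction on the size of the image of \<open>\<phi>\<close>: as long as it contains two
  nonadjacent vertices, one of their fibres is merged into the other in the favourable
  direction.\<close>

lemma exists_blowup_of_clique:
  assumes G: "pair_graph G" and \<phi>: "\<phi> \<in> pverts G \<rightarrow> pverts G"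
  shows "\<exists>\<psi>\<in>pverts G \<rightarrow> pverts G.
    (\<forall>u\<in>\<psi> ` pverts G. \<forall>v\<in>\<psi> ` pverts G. u \<noteq> v \<longrightarrow> (u, v) \<in> parcs G) \<and>
    blowup_weight t G w (fibre_size G \<phi>) \<le> blowup_weight t G w (fibre_size G \<psi>)"
  using \<phi>
proof (induction "card (\<phi> ` pverts G)" arbitrary: \<phi> rule: less_induct)
  case less
  note fin = pair_graphD(1)[OF G]
  let ?F = "\<lambda>\<phi>. blowup_weight t G w (fibre_size G \<phi>)"
  let ?merge = "\<lambda>u v p. if \<phi> p = u then v else \<phi> p"
  show ?case
  proof (cases "\<forall>u\<in>\<phi> ` pverts G. \<forall>v\<in>\<phi> ` pverts G. u \<noteq> v \<longrightarrow> (u, v) \<in> parcs G")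
    case True
    then show ?thesis using less.prems by blast
  next
    case False
    then obtain u v where uv: "u \<in> \<phi> ` pverts G" "v \<in> \<phi> ` pverts G" "u \<noteq> v" "(u, v) \<notin> parcs G"
      by blast
    have pos: "0 < fibre_size G \<phi> x" if "x \<in> \<phi> ` pverts G" for x
      using that fin by (auto simp: fibre_size_def card_gt_0_iff)
    have "?F \<phi> \<le> ?F (?merge u v) \<or> ?F \<phi> \<le> ?F (?merge v u)"
      using blowup_weight_shift_mass[OF G uv(3,4) pos[OF uv(1)] pos[OF uv(2)], of t w]
        fibre_size_merge[OF G, of _ _ \<phi>] uv(3)
      by (simp add: add.commute)
    then obtain a b where ab: "a \<in> \<phi> ` pverts G" "b \<in> \<phi> ` pverts G" "a \<noteq> b" "?F \<phi> \<le> ?F (?merge a b)"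
      using uv by metis
    \<comment> \<open>Merging removes \<open>a\<close> from the image and adds nothing, since
      \<open>b\<close> was already there.\<close>
    have "?merge a b ` pverts G \<subseteq> \<phi> ` pverts G - {a}" using ab by auto
    then have "?merge a b ` pverts G \<subset> \<phi> ` pverts G" using ab(1) by blast
    then have "card (?merge a b ` pverts G) < card (\<phi> ` pverts G)"
      by (rule psubset_card_mono[OF finite_imageI[OF fin]])
    moreover have "?merge a b \<in> pverts G \<rightarrow> pverts G" using less.prems ab(2) by auto
    ultimately obtain \<psi> where "\<psi> \<in> pverts G \<rightarrow> pverts G"
      "\<forall>u\<in>\<psi> ` pverts G. \<forall>v\<in>\<psi> ` pverts G. u \<noteq> v \<longrightarrow> (u, v) \<in> parcs G" "?F (?merge a b) \<le> ?F \<psi>"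
      using less.hyps by blast
    then show ?thesis using ab(4) by (blast intro: order_trans)
  qed
qed

section \<open>Transfer to a complete multipartite graph\<close>

text \<open>The parts are the fibres over the image of \<open>\<phi>\<close>, hence nonempty.
  Distinct fibres have adjacent images, while vertices of one fibre are nonadjacent because
  \<open>G\<close> has no loops.\<close>

lemma complete_multipartite_pullback_graph:
  assumes G: "pair_graph G"
    and adj: "\<forall>u\<in>\<phi> ` pverts G. \<forall>v\<in>\<phi> ` pverts G. u \<noteq> v \<longrightarrow> (u, v) \<in> parcs G"
  shows "complete_multipartite (pullback_graph \<phi> G)"
  unfolding complete_multipartite_def
proof (intro conjI exI[of _ "(\<lambda>x. {p \<in> pverts G. \<phi> p = x}) ` \<phi> ` pverts G"] ballI)
  show "pair_graph (pullback_graph \<phi> G)" by (rule pair_graph_pullback_graph[OF G])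
  show "partition_on (pverts (pullback_graph \<phi> G)) ((\<lambda>x. {p \<in> pverts G. \<phi> p = x}) ` \<phi> ` pverts G)"
    by (rule partition_onI) (auto simp: disjnt_def)
  show "(u, v) \<in> parcs (pullback_graph \<phi> G) \<longleftrightarrow>
      \<not> (\<exists>A\<in>(\<lambda>x. {p \<in> pverts G. \<phi> p = x}) ` \<phi> ` pverts G. u \<in> A \<and> v \<in> A)"
    if "u \<in> pverts (pullback_graph \<phi> G)" "v \<in> pverts (pullback_graph \<phi> G)" for u v
    using that adj pair_graphD(3)[OF G, of "\<phi> v"] by (auto simp: pullback_graph_def)
qed

text \<open>Nonnegativity is passed on as an implication so that the result applies to both kinds of
  dual weights.\<close>

lemma complete_multipartite_dual_exists:
  assumes G: "pair_graph G" and dual: "clique_dual t G c w"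
  obtains H w' where "complete_multipartite H" "pverts H = pverts G" "clique_dual t H c w'"
    "(\<Sum>T\<in>cliques_of_size t G. w T) \<le> (\<Sum>T\<in>cliques_of_size t H. w' T)"
    "(\<And>T. T \<in> cliques_of_size t G \<Longrightarrow> 0 \<le> w T) \<Longrightarrow> (\<And>T. T \<in> cliques_of_size t H \<Longrightarrow> 0 \<le> w' T)"
proof -
  obtain \<psi> where \<psi>: "\<psi> \<in> pverts G \<rightarrow> pverts G"
    and adj: "\<forall>u\<in>\<psi> ` pverts G. \<forall>v\<in>\<psi> ` pverts G. u \<noteq> v \<longrightarrow> (u, v) \<in> parcs G"
    and le: "blowup_weight t G w (fibre_size G id) \<le> blowup_weight t G w (fibre_size G \<psi>)"
    using exists_blowup_of_clique[OF G, of id t w] by auto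
  \<comment> \<open>The merging starts from the identity, whose fibres over vertices are singletons,
    so the initial value is the total weight of \<open>w\<close>.\<close>
  have "(\<Prod>x\<in>S. fibre_size G id x) = 1" if "S \<in> cliques_of_size t G" for S
  proof (rule prod.neutral, rule ballI)
    fix x assume "x \<in> S"
    then have "{p \<in> pverts G. id p = x} = {x}" using that by (auto simp: cliques_of_size_def cliques_def)
    then show "fibre_size G id x = 1" by (simp only: fibre_size_def) simp
  qed
  then have "(\<Sum>T\<in>cliques_of_size t G. w T) = blowup_weight t G w (fibre_size G id)"
    by (simp add: blowup_weight_def)
  then have "(\<Sum>T\<in>cliques_of_size t G. w T)
      \<le> (\<Sum>T\<in>cliques_of_size t (pullback_graph \<psi> G). w (\<psi> ` T))"
    using le sum_dual_pullback[OF G \<psi>] by simp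
  then show thesis
    using that[OF complete_multipartite_pullback_graph[OF G adj] _ clique_dual_pullback[OF G \<psi> dual]]
      cliques_of_size_pullback_graph[OF G \<psi>] by auto
qed

theorem theorem1p7:
  fixes G :: "'a pair_pre_digraph" and n t :: nat and c :: "nat \<Rightarrow> real"
  assumes "pair_graph G" and "card (pverts G) = n"
    and "t \<ge> 2"
    and "\<And>i. i \<ge> 1 \<Longrightarrow> c i \<ge> 0"
  shows "\<exists>(H :: 'a pair_pre_digraph) (H' :: 'a pair_pre_digraph).
      complete_multipartite H \<and> card (pverts H) = n \<and>
      complete_multipartite H' \<and> card (pverts H') = n \<and>
      frac_cov t G c \<le> frac_cov t H c \<and>
      frac_dec t G c \<le> frac_dec t H' c"
proof -
  note G = assms(1) and c = assms(4)
  obtain w where w: "clique_dual t G c w" "\<And>T. T \<in> cliques_of_size t G \<Longrightarrow> 0 \<le> w T"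
    "frac_cov t G c \<le> (\<Sum>T\<in>cliques_of_size t G. w T)"
    using frac_cov_dual_exists[where c = c, OF G c] by blast
  obtain H w1 where H: "complete_multipartite H" "pverts H = pverts G" "clique_dual t H c w1"
    "(\<Sum>T\<in>cliques_of_size t G. w T) \<le> (\<Sum>T\<in>cliques_of_size t H. w1 T)"
    "\<And>T. T \<in> cliques_of_size t H \<Longrightarrow> 0 \<le> w1 T"
    using complete_multipartite_dual_exists[OF G w(1)] w(2) by metis
  \<comment> \<open>Strong duality in \<open>G\<close>, the increase of total weight from
    \<open>w\<close> to \<open>w1\<close>, and weak duality in \<open>H\<close> are chained.\<close>
  have "frac_cov t G c \<le> frac_cov t H c"
    using frac_cov_ge_dual[where c = c, OF _ c H(3,5)] H(1,4) w(3) by (force simp: complete_multipartite_def)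
  moreover obtain v where v: "clique_dual t G c v" "frac_dec t G c \<le> (\<Sum>T\<in>cliques_of_size t G. v T)"
    using frac_dec_dual_exists[where c = c, OF G c] by blast
  \<comment> \<open>The merging directions depend on the dual weight, so \<open>H'\<close> may
    differ from \<open>H\<close>.\<close>
  obtain H' v1 where H': "complete_multipartite H'" "pverts H' = pverts G" "clique_dual t H' c v1"
    "(\<Sum>T\<in>cliques_of_size t G. v T) \<le> (\<Sum>T\<in>cliques_of_size t H'. v1 T)"
    using complete_multipartite_dual_exists[OF G v(1)] by metis
  have "frac_dec t G c \<le> frac_dec t H' c"
    using frac_dec_ge_dual[where c = c, OF _ c H'(3)] H'(1,4) v(2) by (force simp: complete_multipartite_def)
  ultimately show ?thesis using H(1,2) H'(1,2) assms(2) by metis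
qed

end
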